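(* Let $T\ge 2$ be an integer and $p\in(0,1)$. Let $\{U_n\}_{n\ge 0}$ be a sequence of independent random variables with $U_{kT}=1$ almost surely for all $k\ge 0$ and $U_n$ Bernoulli with parameter $p$ for every $n\ge 0$ that is not a multiple of $T$. Let $\{X_n\}_{n\ge 0}$ be a strictly stationary sequence of positive random variables with continuous marginal distribution function $F$, independent of $\{U_n\}_{n\ge 0}$. Define $$Y_n=U_nX_n+(1-U_n)\max_{[(n-1)/T]\,T\le i\le n-1}U_iX_i,\qquad n\ge 1 .$$ Let $\{u_n\}_{n\ge1}$ be any sequence of real numbers such that $\{Y_n\}$ satisfies condition $D(u_n)$, with sequence $\ell_n=o(n)$ and mixing coefficients $\alpha_{n,\ell_n}\to 0$, and let $\{k_n\}_{n\ge1}$ be a sequence of positive integers with $k_n\to+\infty$, $k_n\ell_n/n\to0$ and $k_n\alpha_{n,\ell_n}\to0$. If $$nP\Big(\max_{0\le j\le T}X_j>u_n,\ M^{(\mathbf X)}_{T+1,\,[\frac{n}{k_nT}]T+T}>u_n\Big)\longrightarrow0\quad (n\to+\infty),$$ then condition $D_T^{(T)}(u_n)$ holds for $\{Y_n\}_{n\ge1}$.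
   Context: $[a]$ denotes the integer part of the real number $a$. For a sequence $\mathbf W=\{W_n\}$ of random variables, $M^{(\mathbf W)}_{i,j}=\max_{i\le m\le j}W_m$ for $i\le j$ and $M^{(\mathbf W)}_{i,j}=-\infty$ for $i>j$. Condition $D(u_n)$ for $\mathbf W$: there is a sequence $\ell_n=o(n)$ such that $\alpha_{n,\ell_n}\to0$, where $\alpha_{n,\ell_n}$ is the supremum of $|P(M^{(\mathbf W)}_{i_1,i_1+a}\le u_n, M^{(\mathbf W)}_{j_1,j_1+b}\le u_n)-P(M^{(\mathbf W)}_{i_1,i_1+a}\le u_n)P(M^{(\mathbf W)}_{j_1,j_1+b}\le u_n)|$ over all integers with $1\le i_1<i_1+a+\ell_n\le j_1<j_1+b\le n$. Condition $D_T^{(s)}(u_n)$ ($s\ge1$) for $\{Y_n\}$ (which is a $T$-periodic sequence): $\{Y_n\}$ satisfies $D(u_n)$ and there is a sequence of integers $k_n\to+\infty$ with $k_n\ell_n/n\to0$, $k_n\alpha_{n,\ell_n}\to0$ and $$\lim_{n\to+\infty}\frac nT\sum_{i=1}^{T}P\Big(Y_i>u_n\ge M^{(\mathbf Y)}_{i+1,i+s-1},\ M^{(\mathbf Y)}_{i+s,[\frac{n}{k_nT}]T}>u_n\Big)=0.$$ *)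

theory Defs
  imports "HOL-Probability.Probability" "HOL-Library.Landau_Symbols"
begin

definition seq_max :: "(nat \<Rightarrow> 'a \<Rightarrow> real) \<Rightarrow> nat \<Rightarrow> nat \<Rightarrow> 'a \<Rightarrow> ereal" where
  "seq_max W i j \<omega> = (if i \<le> j then ereal (MAX m\<in>{i..j}. W m \<omega>) else -\<infinity>)"

definition strictly_stationary :: "'a measure \<Rightarrow> (nat \<Rightarrow> 'a \<Rightarrow> real) \<Rightarrow> bool" where
  "strictly_stationary M X \<longleftrightarrow>
     (\<forall>n. X n \<in> borel_measurable M) \<and>
     (\<forall>J h. finite J \<longrightarrow>
        distr M (\<Pi>\<^sub>M i\<in>J. borel) (\<lambda>\<omega>. \<lambda>i\<in>J. X (i + h) \<omega>) =
        distr M (\<Pi>\<^sub>M i\<in>J. borel) (\<lambda>\<omega>. \<lambda>i\<in>J. X i \<omega>))"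

text \<open>
  The mixing coefficient of condition D at index n for the level v and the separation l.
  The indices i, j, a, b are natural numbers, which loses nothing: for a negative a the first
  maximum is -\<infinity> and the difference of probabilities vanishes.  All the values are
  nonnegative, so inserting 0 only fixes the supremum over the empty set to be 0.
\<close>
definition mixing_coeff ::
    "'a measure \<Rightarrow> (nat \<Rightarrow> 'a \<Rightarrow> real) \<Rightarrow> real \<Rightarrow> nat \<Rightarrow> nat \<Rightarrow> real" where
  "mixing_coeff M W v n l = Sup (insert 0
     {\<bar>measure M {\<omega> \<in> space M. seq_max W i (i + a) \<omega> \<le> ereal v \<and>
                               seq_max W j (j + b) \<omega> \<le> ereal v}
       - measure M {\<omega> \<in> space M. seq_max W i (i + a) \<omega> \<le> ereal v}
       * measure M {\<omega> \<in> space M. seq_max W j (j + b) \<omega> \<le> ereal v}\<bar> | i j a b.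
       1 \<le> i \<and> i < i + a + l \<and> i + a + l \<le> j \<and> j < j + b \<and> j + b \<le> n})"

text \<open>Condition D for the level sequence u, with the separation sequence l as its witness.\<close>
definition condition_D_with ::
    "'a measure \<Rightarrow> (nat \<Rightarrow> 'a \<Rightarrow> real) \<Rightarrow> (nat \<Rightarrow> real) \<Rightarrow> (nat \<Rightarrow> nat) \<Rightarrow> bool" where
  "condition_D_with M W u l \<longleftrightarrow>
     (\<lambda>n. real (l n)) \<in> o(\<lambda>n. real n) \<and>
     (\<lambda>n. mixing_coeff M W (u n) n (l n)) \<longlonglongrightarrow> 0"

text \<open>
  The sequence l in the conditions on k is the one witnessing condition D, so both sequences are
  quantified together.  As natural number division, \<open>n div (k n * T)\<close> is the integer
  part of \<open>n / (k n * T)\<close>.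
\<close>
definition condition_D_periodic ::
    "'a measure \<Rightarrow> (nat \<Rightarrow> 'a \<Rightarrow> real) \<Rightarrow> nat \<Rightarrow> nat \<Rightarrow> (nat \<Rightarrow> real) \<Rightarrow> bool" where
  "condition_D_periodic M Y T s u \<longleftrightarrow>
     (\<exists>l k. condition_D_with M Y u l \<and>
        filterlim k at_top sequentially \<and>
        (\<lambda>n. real (k n) * real (l n) / real n) \<longlonglongrightarrow> 0 \<and>
        (\<lambda>n. real (k n) * mixing_coeff M Y (u n) n (l n)) \<longlonglongrightarrow> 0 \<and>
        (\<lambda>n. real n / real T * (\<Sum>i=1..T. measure M {\<omega> \<in> space M.
            Y i \<omega> > u n \<and> ereal (u n) \<ge> seq_max Y (i + 1) (i + s - 1) \<omega> \<and>
            seq_max Y (i + s) ((n div (k n * T)) * T) \<omega> > ereal (u n)})) \<longlonglongrightarrow> 0)"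

end

theory Submission
  imports Defs
begin

text \<open>
  Almost surely every \<open>U\<^sub>j\<close> is 0 or 1, so each \<open>Y\<^sub>m\<close> equals some \<open>X\<^sub>j\<close> with j between the last
  multiple of T strictly before m and m itself, and j = m if \<open>U\<^sub>m = 1\<close>.  For i at most T, an
  exceedance of \<open>Y\<^sub>i\<close> is thus one of \<open>X\<^sub>0, \<dots>, X\<^sub>T\<close>, and an exceedance of \<open>Y\<^sub>m\<close> with m \<open>\<ge>\<close> i + T is
  one of some \<open>X\<^sub>j\<close> with j \<open>\<ge>\<close> T.  Here j = T is impossible: if i < T then \<open>Y\<^sub>T = X\<^sub>T\<close> is among the
  values required to be at most the level, and if i = T then m \<open>\<ge>\<close> 2T, which forces j \<open>\<ge>\<close> 2T since
  \<open>U\<^sub>2\<^sub>T = 1\<close>.  So each of the T events in the sum is almost surely contained in the event of the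
  hypothesis on X.
\<close>

text \<open>On an empty range both sides are false, because the maximum is then minus infinity.
  Later steps can therefore work with a single exceeding index and no case split.\<close>

lemma less_seq_max_iff:
  "ereal v < seq_max W i j \<omega> \<longleftrightarrow> (\<exists>m\<in>{i..j}. v < W m \<omega>)"
  by (auto simp: seq_max_def Max_gr_iff)

lemma sets_less_seq_max [measurable]:
  assumes [measurable]: "\<And>n. W n \<in> borel_measurable M"
  shows "Measurable.pred M (\<lambda>\<omega>. ereal v < seq_max W i j \<omega>)"
  unfolding less_seq_max_iff by measurable

text \<open>If \<open>w m = 0\<close>, the maximum is attained at some index \<open>j\<close> of the
  window. The window starts at a multiple of \<open>T\<close>, where \<open>w\<close> is 1 and
  \<open>x\<close> is positive, so the maximum is positive and \<open>w j\<close> cannot be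
  0.\<close>

lemma imputed_value_cases:
  fixes w x :: "nat \<Rightarrow> real"
  assumes w01: "\<And>j. w j = 0 \<or> w j = 1" and w1: "\<And>j. w (j * T) = 1"
    and pos: "\<And>j. 0 < x j" and "1 \<le> m"
    and y: "y = w m * x m + (1 - w m) * (MAX i\<in>{((m - 1) div T) * T..m - 1}. w i * x i)"
  shows "\<exists>j\<in>{((m - 1) div T) * T..m}. y = x j \<and> (w m = 1 \<longrightarrow> j = m)"
proof (cases "w m = 1")
  case True
  have "((m - 1) div T) * T \<le> m"
    using div_times_less_eq_dividend[of "m - 1" T] by linarith
  then show ?thesis using True y by auto
next
  case False
  let ?b = "((m - 1) div T) * T" and ?g = "\<lambda>i. w i * x i"
  have b: "?b \<in> {?b..m - 1}" by simp
  then have "Max (?g ` {?b..m - 1}) \<in> ?g ` {?b..m - 1}"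
    by (intro Max_in) blast+
  then obtain j where j: "j \<in> {?b..m - 1}" and max: "Max (?g ` {?b..m - 1}) = ?g j"
    by blast
  have "?g ?b \<le> ?g j"
    unfolding max[symmetric] using b by (intro Max_ge) blast+
  then have "w j = 1"
    using w01[of j] w1[of "(m - 1) div T"] pos[of ?b] by auto
  then show ?thesis
    using j max y False w01[of m] by auto
qed

text \<open>Purely deterministic, for one path; the null sets are dealt with separately.\<close>

lemma imputed_exceedances:
  fixes w x y :: "nat \<Rightarrow> real"
  assumes w01: "\<And>j. w j = 0 \<or> w j = 1" and w1: "\<And>j. w (j * T) = 1"
    and pos: "\<And>j. 0 < x j"
    and y: "\<And>m. 1 \<le> m \<Longrightarrow>
      y m = w m * x m + (1 - w m) * (MAX i\<in>{((m - 1) div T) * T..m - 1}. w i * x i)"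
    and i: "1 \<le> i" "i \<le> T" and yi: "v < y i"
    and low: "\<And>m. m \<in> {i + 1..i + T - 1} \<Longrightarrow> y m \<le> v"
    and m: "i + T \<le> m" "v < y m"
  shows "(\<exists>j\<in>{0..T}. v < x j) \<and> (\<exists>j\<in>{T + 1..m}. v < x j)"
proof
  note ex = imputed_value_cases[OF w01 w1 pos _ y]
  show "\<exists>j\<in>{0..T}. v < x j"
    using ex[of i] i yi by auto
  obtain j where j: "((m - 1) div T) * T \<le> j" "j \<le> m" "v < x j" "w m = 1 \<longrightarrow> j = m"
    using ex[of m] i m by auto
  \<comment> \<open>Since \<open>i\<close> is at least 1, \<open>m - 1\<close> is at least
    \<open>T\<close>, so the window of \<open>m\<close> starts no earlier than
    \<open>T\<close>.\<close>
  have "T * 1 \<le> T * ((m - 1) div T)"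
    using i m by (intro mult_le_mono2) (simp add: less_eq_div_iff_mult_less_eq)
  then have "T \<le> j"
    using j(1) unfolding mult.commute[of T] by linarith
  moreover have "j \<noteq> T"
  proof
    assume "j = T"
    show False
    proof (cases "i = T")
      case True
      \<comment> \<open>At \<open>m = 2 * T\<close> the weight is 1 and would force
        \<open>j = m\<close>. Hence \<open>m - 1\<close> is at least \<open>2 * T\<close>, and the
        window starts beyond \<open>T\<close>.\<close>
      have "m \<noteq> 2 * T"
        using j(4) w1[of 2] \<open>j = T\<close> i by auto
      then have "T * 2 \<le> T * ((m - 1) div T)"
        using i m True by (intro mult_le_mono2) (simp add: less_eq_div_iff_mult_less_eq)
      then show False
        using j(1) \<open>j = T\<close> i by (simp add: mult.commute)
    next
      case False
      \<comment> \<open>From \<open>1 \<le> i < T\<close>, the index \<open>T\<close> lies in the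
        range where \<open>y\<close> stays at or below \<open>v\<close>.\<close>
      then have "y T \<le> v" using i by (intro low) auto
      moreover have "y T = x T" using y[of T] w1[of 1] i by simp
      ultimately show False using j(3) \<open>j = T\<close> by simp
    qed
  qed
  ultimately show "\<exists>j\<in>{T + 1..m}. v < x j"
    using j by auto
qed

theorem theorem3p4:
  fixes M :: "'a measure"
    and U X Y :: "nat \<Rightarrow> 'a \<Rightarrow> real"
    and F :: "real \<Rightarrow> real"
    and u :: "nat \<Rightarrow> real"
    and l k :: "nat \<Rightarrow> nat"
    and T :: nat and p :: real
  assumes "prob_space M"
    and "T \<ge> 2" and "0 < p" and "p < 1"
    and "prob_space.indep_vars M (\<lambda>_. borel) U UNIV"
    and "\<And>j. AE \<omega> in M. U (j * T) \<omega> = 1"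
    and "\<And>n. \<not> T dvd n \<Longrightarrow>
           distr M borel (U n) = distr (measure_pmf (bernoulli_pmf p)) borel of_bool"
    and "strictly_stationary M X"
    and "\<And>n. AE \<omega> in M. 0 < X n \<omega>"
    and "\<And>n. cdf (distr M borel (X n)) = F" and "continuous_on UNIV F"
    and "prob_space.indep_var M
           (\<Pi>\<^sub>M n\<in>UNIV. borel) (\<lambda>\<omega> n. X n \<omega>) (\<Pi>\<^sub>M n\<in>UNIV. borel) (\<lambda>\<omega> n. U n \<omega>)"
    and "\<And>n \<omega>. n \<ge> 1 \<Longrightarrow> \<omega> \<in> space M \<Longrightarrow>
           Y n \<omega> = U n \<omega> * X n \<omega>
             + (1 - U n \<omega>) * (MAX i\<in>{((n - 1) div T) * T..n - 1}. U i \<omega> * X i \<omega>)"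
    and "condition_D_with M Y u l"
    and "\<And>n. n \<ge> 1 \<Longrightarrow> k n > 0"
    and "filterlim k at_top sequentially"
    and "(\<lambda>n. real (k n) * real (l n) / real n) \<longlonglongrightarrow> 0"
    and "(\<lambda>n. real (k n) * mixing_coeff M Y (u n) n (l n)) \<longlonglongrightarrow> 0"
    and "(\<lambda>n. real n * measure M {\<omega> \<in> space M. seq_max X 0 T \<omega> > ereal (u n) \<and>
            seq_max X (T + 1) ((n div (k n * T)) * T + T) \<omega> > ereal (u n)}) \<longlonglongrightarrow> 0"
  shows "condition_D_periodic M Y T T u"
proof -
  interpret prob_space M by fact
  have X [measurable]: "X n \<in> borel_measurable M" for n
    using assms(8) by (simp add: strictly_stationary_def)
  have U [measurable]: "U n \<in> borel_measurable M" for n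
    using assms(5) by (simp add: indep_vars_def2)
  \<comment> \<open>Away from multiples of \<open>T\<close> only the law of \<open>U n\<close> is
    given, so its support is transferred back through the distribution.\<close>
  have "AE \<omega> in M. U n \<omega> = 0 \<or> U n \<omega> = 1" for n
  proof (cases "T dvd n")
    case True
    then show ?thesis using assms(6)[of "n div T"] by auto
  next
    case False
    have "AE z in distr (measure_pmf (bernoulli_pmf p)) borel of_bool. z = 0 \<or> z = (1::real)"
      by (subst AE_distr_iff) auto
    then have "AE z in distr M borel (U n). z = 0 \<or> z = 1"
      by (simp only: assms(7)[OF False])
    then show ?thesis by (subst (asm) AE_distr_iff) auto
  qed
  then have U01: "AE \<omega> in M. \<forall>n. U n \<omega> = 0 \<or> U n \<omega> = 1"
    by (simp add: AE_all_countable)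
  have U1: "AE \<omega> in M. \<forall>j. U (j * T) \<omega> = 1" and pos: "AE \<omega> in M. \<forall>n. 0 < X n \<omega>"
    using assms(6,9) by (simp_all add: AE_all_countable)
  define A where "A n i = {\<omega> \<in> space M. Y i \<omega> > u n \<and>
      ereal (u n) \<ge> seq_max Y (i + 1) (i + T - 1) \<omega> \<and>
      seq_max Y (i + T) ((n div (k n * T)) * T) \<omega> > ereal (u n)}" for n i
  define B where "B n = {\<omega> \<in> space M. seq_max X 0 T \<omega> > ereal (u n) \<and>
      seq_max X (T + 1) ((n div (k n * T)) * T + T) \<omega> > ereal (u n)}" for n
  have "prob (A n i) \<le> prob (B n)" if i: "i \<in> {1..T}" for n i
  proof (rule finite_measure_mono_AE)
    show "AE \<omega> in M. \<omega> \<in> A n i \<longrightarrow> \<omega> \<in> B n"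
      using U01 U1 pos
    proof eventually_elim
      case \<omega>: (elim \<omega>)
      show ?case
      proof
        assume A: "\<omega> \<in> A n i"
        from A obtain m where m: "m \<in> {i + T..(n div (k n * T)) * T}" "u n < Y m \<omega>"
          by (auto simp: A_def less_seq_max_iff)
        have "\<not> ereal (u n) < seq_max Y (i + 1) (i + T - 1) \<omega>"
          using A by (simp add: A_def not_less)
        then have low: "Y m' \<omega> \<le> u n" if "m' \<in> {i + 1..i + T - 1}" for m'
          using that unfolding less_seq_max_iff by (meson not_less)
        have "(\<exists>j\<in>{0..T}. u n < X j \<omega>) \<and> (\<exists>j\<in>{T + 1..m}. u n < X j \<omega>)"
        proof (rule imputed_exceedances)
          show "U j \<omega> = 0 \<or> U j \<omega> = 1" "U (j * T) \<omega> = 1" "0 < X j \<omega>" for j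
            using \<omega> by blast+
          show "Y m' \<omega> = U m' \<omega> * X m' \<omega>
              + (1 - U m' \<omega>) * (MAX i\<in>{((m' - 1) div T) * T..m' - 1}. U i \<omega> * X i \<omega>)"
            if "1 \<le> m'" for m'
            using that A by (intro assms(13)) (simp_all add: A_def)
          show "u n < Y i \<omega>" using A by (simp add: A_def)
          show "1 \<le> i" "i \<le> T" "i + T \<le> m" using i m by simp_all
          show "Y m' \<omega> \<le> u n" if "m' \<in> {i + 1..i + T - 1}" for m'
            using that by (rule low)
          show "u n < Y m \<omega>" by (rule m(2))
        qed
        moreover have "{T + 1..m} \<subseteq> {T + 1..(n div (k n * T)) * T + T}"
          using m by auto
        ultimately show "\<omega> \<in> B n"
          using A by (auto simp: A_def B_def less_seq_max_iff)
      qed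
    qed
    show "B n \<in> sets M"
      unfolding B_def by measurable
  qed
  \<comment> \<open>The bound is the same for all \<open>T\<close> summands, so the factor
    \<open>T\<close> cancels against the averaging in the condition.\<close>
  then have "(\<Sum>i=1..T. prob (A n i)) \<le> real T * prob (B n)" for n
    using sum_bounded_above[of "{1..T}" "\<lambda>i. prob (A n i)" "prob (B n)"] by simp
  then have "real n / real T * (\<Sum>i=1..T. prob (A n i)) \<le> real n / real T * (real T * prob (B n))" for n
    by (intro mult_left_mono) auto
  then have upper: "real n / real T * (\<Sum>i=1..T. prob (A n i)) \<le> real n * prob (B n)" for n
    using \<open>T \<ge> 2\<close> by simp
  have lower: "0 \<le> real n / real T * (\<Sum>i=1..T. prob (A n i))" for n
    by (simp add: sum_nonneg)
  have "(\<lambda>n. real n * prob (B n)) \<longlonglongrightarrow> 0"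
    using assms(19) by (simp only: B_def)
  then have "(\<lambda>n. real n / real T * (\<Sum>i=1..T. prob (A n i))) \<longlonglongrightarrow> 0"
    by (rule tendsto_sandwich[OF _ _ tendsto_const, rotated 2])
      (use lower upper in \<open>blast intro: always_eventually\<close>)+
  then have "(\<lambda>n. real n / real T * (\<Sum>i=1..T. measure M {\<omega> \<in> space M. Y i \<omega> > u n \<and>
      ereal (u n) \<ge> seq_max Y (i + 1) (i + T - 1) \<omega> \<and>
      seq_max Y (i + T) ((n div (k n * T)) * T) \<omega> > ereal (u n)})) \<longlonglongrightarrow> 0"
    by (simp only: A_def)
  \<comment> \<open>The given \<open>l\<close> and \<open>k\<close> are the witnesses.\<close>
  with assms(14,16,17,18) show ?thesis
    unfolding condition_D_periodic_def
    by blast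
qed

end
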